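(* Let $G=(V,E)$ be a graph and let $OPT$ be an optimal solution of Minimum 2-Club Cover on $G$. Then the algorithm Club-Cover-Approx on input $G$ returns a cover of $G$ by $2$-clubs consisting of at most $2|V|^{1/2}\log^{3/2}|V|\cdot|OPT|$ $2$-clubs.
   Context: For $V'\subseteq V$, $G[V']$ is a $2$-club if it has diameter at most $2$. Minimum 2-Club Cover: given $G=(V,E)$, find a minimum-cardinality collection of subsets of $V$, each inducing a $2$-club, whose union is $V$. $N[v]$ denotes the closed neighborhood $\{v\}\cup\{u:\{u,v\}\in E\}$. Algorithm Club-Cover-Approx: set $V':=V$ (uncovered vertices) and $\mathcal{S}:=\emptyset$; while $V'\neq\emptyset$, choose a vertex $v\in V$ maximizing $|N[v]\cap V'|$, add $N[v]$ to $\mathcal{S}$, and set $V':=V'\setminus N[v]$; return $\mathcal{S}$.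
   Formalization: The size bound is stated only for |V| ≠ 1, since for a one-vertex graph log|V| = 0 makes the bound 0 while the algorithm returns one 2-club; that the algorithm returns a cover by 2-clubs is stated for all graphs, and log is the natural logarithm. *)

theory Defs
  imports "Graph_Theory.Shortest_Path" "Graph_Theory.Digraph_Component" "HOL-Library.While_Combinator"
begin

text \<open>
  Undirected simple graphs are the symmetric, loop-free, finite digraphs without parallel arcs
  of locale \<^locale>\<open>graph\<close>; the edge \<open>{u, v}\<close> is the pair of arcs between \<open>u\<close> and \<open>v\<close>.
  With unit arc weights, \<open>\<mu>\<close> is the usual distance, which is infinite if there is no walk.
  The graph without vertices has diameter \<open>-\<infinity>\<close>, so the empty set counts as a 2-club; this does not
  affect the minimum size of a cover.
\<close>

definition diameter :: "('a, 'b) pre_digraph \<Rightarrow> ereal" where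
  "diameter G = (SUP u\<in>verts G. SUP v\<in>verts G. wf_digraph.\<mu> G (\<lambda>_. 1) u v)"

definition two_club :: "('a, 'b) pre_digraph \<Rightarrow> 'a set \<Rightarrow> bool" where
  "two_club G X \<longleftrightarrow> X \<subseteq> verts G \<and> diameter (G \<restriction> X) \<le> 2"

definition two_club_cover :: "('a, 'b) pre_digraph \<Rightarrow> 'a set set \<Rightarrow> bool" where
  "two_club_cover G \<S> \<longleftrightarrow> (\<forall>X\<in>\<S>. two_club G X) \<and> \<Union>\<S> = verts G"

definition minimum_two_club_cover :: "('a, 'b) pre_digraph \<Rightarrow> 'a set set \<Rightarrow> bool" where
  "minimum_two_club_cover G \<S> \<longleftrightarrow> is_arg_min card (two_club_cover G) \<S>"

definition closed_neighborhood :: "('a, 'b) pre_digraph \<Rightarrow> 'a \<Rightarrow> 'a set" where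
  "closed_neighborhood G v = {v} \<union> {u. u \<rightarrow>\<^bsub>G\<^esub> v}"

text \<open>
  The greedy choice does not specify how ties are broken. A selection rule \<open>sel\<close> maps the set of
  uncovered vertices to a vertex attaining the maximum; since that set strictly shrinks in every
  iteration, each possible run of the algorithm is the run for some such rule.
\<close>

definition greedy_rule :: "('a, 'b) pre_digraph \<Rightarrow> ('a set \<Rightarrow> 'a) \<Rightarrow> bool" where
  "greedy_rule G sel \<longleftrightarrow>
     (\<forall>U. U \<subseteq> verts G \<and> U \<noteq> {} \<longrightarrow>
        is_arg_max (\<lambda>v. card (closed_neighborhood G v \<inter> U)) (\<lambda>v. v \<in> verts G) (sel U))"

text \<open>The result is \<^const>\<open>None\<close> iff the loop does not terminate.\<close>

definition club_cover_approx ::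
    "('a set \<Rightarrow> 'a) \<Rightarrow> ('a, 'b) pre_digraph \<Rightarrow> 'a set set option" where
  "club_cover_approx sel G =
     map_option snd
       (while_option (\<lambda>(U, \<S>). U \<noteq> {})
          (\<lambda>(U, \<S>). let C = closed_neighborhood G (sel U) in (U - C, insert C \<S>))
          (verts G, {}))"

end

theory Submission
  imports Defs "HOL-Analysis.Harmonic_Numbers"
begin

text \<open>
  Let \<open>n = |V|\<close> and \<open>k = |OPT|\<close>. Let \<open>X\<close> be a 2-club, \<open>W \<subseteq> X\<close>, and let \<open>d\<close> be the minimum of
  \<open>|N[x] \<inter> X|\<close> over \<open>x \<in> X\<close>, attained at \<open>x\<close>. The \<open>d\<close> vertices of \<open>N[x] \<inter> X\<close> dominate \<open>X\<close>, so one of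
  them covers at least \<open>|W| / d\<close> vertices of \<open>W\<close>; on the other hand every \<open>w \<in> W\<close> lies in at least
  \<open>d\<close> neighborhoods \<open>N[v]\<close> with \<open>v \<in> X\<close>, so on average these cover \<open>|W| d / |X|\<close> vertices of \<open>W\<close>.
  The larger of the two values is at least \<open>|W| / sqrt n\<close>. Summing over the clubs of the optimal
  cover, each greedy step covers at least a fraction \<open>1 / (k sqrt n)\<close> of the uncovered
  vertices, so there are at most \<open>1 + k sqrt n ln n\<close> steps. This implies the claim directly for
  \<open>n \<ge> 3\<close>, where \<open>ln n \<ge> 1\<close>, and by a numerical check for \<open>n = 2\<close>.
\<close>

section \<open>2-clubs in terms of adjacency\<close>

lemma (in wf_digraph) awalk_cost_unit: "awalk_cost (\<lambda>_. 1) p = real (length p)"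
  by (induct p) auto

text \<open>Unit costs are walk lengths, hence integers: if no walk has length at most 2, all costs
  are at least 3, and so is their infimum, which is infinite when there is no walk at all.\<close>

lemma (in wf_digraph) unit_distance_le_2_iff:
  "\<mu> (\<lambda>_. 1) u v \<le> 2 \<longleftrightarrow> (\<exists>p. awalk u p v \<and> length p \<le> 2)"
proof
  assume le: "\<mu> (\<lambda>_. 1) u v \<le> 2"
  show "\<exists>p. awalk u p v \<and> length p \<le> 2"
  proof (rule ccontr)
    assume "\<not> ?thesis"
    then have "3 \<le> length p" if "awalk u p v" for p
      using that by force
    then have "ereal 3 \<le> \<mu> (\<lambda>_. 1) u v"
      unfolding \<mu>_def by (intro INF_greatest) (auto simp: awalk_cost_unit)
    then have "ereal 3 \<le> 2"
      using le by (rule order_trans)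
    then show False
      by simp
  qed
next
  assume "\<exists>p. awalk u p v \<and> length p \<le> 2"
  then obtain p where p: "awalk u p v" "length p \<le> 2"
    by blast
  have "\<mu> (\<lambda>_. 1) u v \<le> ereal (length p)"
    using min_cost_le_walk_cost[OF p(1)] by (metis awalk_cost_unit)
  also have "\<dots> \<le> 2"
    using p(2) by simp
  finally show "\<mu> (\<lambda>_. 1) u v \<le> 2" .
qed

lemma (in wf_digraph) awalk_length_le_2_iff:
  "(\<exists>p. awalk u p v \<and> length p \<le> 2) \<longleftrightarrow>
     u = v \<and> u \<in> verts G \<or> u \<rightarrow> v \<or> (\<exists>w. u \<rightarrow> w \<and> w \<rightarrow> v)" (is "?L \<longleftrightarrow> ?R")
proof
  assume ?L
  then obtain p where p: "awalk u p v" "length p \<le> 2"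
    by blast
  then consider "p = []" | e where "p = [e]" | e f where "p = [e, f]"
    by (cases p; cases "tl p"; cases "tl (tl p)") auto
  then show ?R
  proof cases
    case 3
    then have "u \<rightarrow> head G e" "head G e \<rightarrow> v"
      using p in_arcs_imp_in_arcs_ends[of e] in_arcs_imp_in_arcs_ends[of f]
      by (auto simp: awalk_simps)
    then show ?thesis
      by blast
  qed (use p in \<open>auto simp: awalk_simps intro: in_arcs_imp_in_arcs_ends\<close>)
next
  assume ?R
  then consider "u = v" "u \<in> verts G" | "u \<rightarrow> v" | w where "u \<rightarrow> w" "w \<rightarrow> v"
    by blast
  then show ?L
  proof cases
    case 1
    then show ?thesis
      by (intro exI[of _ "[]"]) (simp add: awalk_Nil_iff)
  next
    case 2
    then obtain e where "e \<in> arcs G" "tail G e = u" "head G e = v"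
      by auto
    then show ?thesis
      by (intro exI[of _ "[e]"]) (auto simp: awalk_simps)
  next
    case 3
    obtain e where "e \<in> arcs G" "tail G e = u" "head G e = w"
      using 3(1) by auto
    moreover obtain f where "f \<in> arcs G" "tail G f = w" "head G f = v"
      using 3(2) by auto
    ultimately show ?thesis
      by (intro exI[of _ "[e, f]"]) (auto simp: awalk_simps)
  qed
qed

lemma dominates_induce_subgraph_iff:
  "u \<rightarrow>\<^bsub>G \<restriction> X\<^esub> v \<longleftrightarrow> u \<rightarrow>\<^bsub>G\<^esub> v \<and> u \<in> X \<and> v \<in> X"
  by (auto simp: arcs_ends_def arc_to_ends_def image_iff)

text \<open>Distances are measured in \<open>G \<restriction> X\<close>, which forces the middle
  vertex \<open>w\<close> into \<open>X\<close>.\<close>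

lemma (in wf_digraph) two_club_iff:
  "two_club G X \<longleftrightarrow>
     X \<subseteq> verts G \<and> (\<forall>u\<in>X. \<forall>v\<in>X. u = v \<or> u \<rightarrow> v \<or> (\<exists>w\<in>X. u \<rightarrow> w \<and> w \<rightarrow> v))"
proof -
  interpret H: wf_digraph "G \<restriction> X" ..
  have "Defs.diameter (G \<restriction> X) \<le> 2 \<longleftrightarrow> (\<forall>u\<in>X. \<forall>v\<in>X. H.\<mu> (\<lambda>_. 1) u v \<le> 2)"
    by (auto simp: Defs.diameter_def SUP_le_iff)
  also have "\<dots> \<longleftrightarrow> (\<forall>u\<in>X. \<forall>v\<in>X. u = v \<or> u \<rightarrow> v \<or> (\<exists>w\<in>X. u \<rightarrow> w \<and> w \<rightarrow> v))"
    unfolding H.unit_distance_le_2_iff H.awalk_length_le_2_iff dominates_induce_subgraph_iff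
    by auto
  finally show ?thesis
    by (simp only: two_club_def)
qed

section \<open>Closed neighborhoods and the greedy loop\<close>

context graph
begin

lemma closed_neighborhood_sym:
  "u \<in> closed_neighborhood G v \<longleftrightarrow> v \<in> closed_neighborhood G u"
  using sym_arcs by (auto simp: closed_neighborhood_def intro: graph_symmetric)

lemma self_in_closed_neighborhood: "v \<in> closed_neighborhood G v"
  by (simp add: closed_neighborhood_def)

text \<open>Any two neighbors of \<open>v\<close> have \<open>v\<close> itself as a common
  neighbor.\<close>

lemma two_club_closed_neighborhood:
  assumes "v \<in> verts G"
  shows "two_club G (closed_neighborhood G v)"
  unfolding two_club_iff closed_neighborhood_def
  using assms by (auto intro: graph_symmetric)

lemma two_club_max_coverage:
  assumes club: "two_club G X" and WX: "W \<subseteq> X"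
    and M: "\<And>v. v \<in> verts G \<Longrightarrow> card (closed_neighborhood G v \<inter> W) \<le> M"
  shows "real (card W) \<le> sqrt (real (card (verts G))) * real M"
proof (cases "W = {}")
  case False
  let ?N = "closed_neighborhood G"
  have XV: "X \<subseteq> verts G"
    using club by (simp add: two_club_iff)
  then have fin: "finite X" "finite W"
    using WX by (auto intro: finite_subset[OF _ finite_verts] dest: finite_subset)
  have "X \<noteq> {}"
    using False WX by auto
  then obtain x where x: "x \<in> X" and
    x_min: "\<And>y. y \<in> X \<Longrightarrow> card (?N x \<inter> X) \<le> card (?N y \<inter> X)"
    using fin(1) ex_min_if_finite[of "(\<lambda>y. card (?N y \<inter> X)) ` X"] by (force simp: not_less)
  define d where "d = card (?N x \<inter> X)"
  have "d > 0"
    using x fin self_in_closed_neighborhood by (auto simp: d_def card_gt_0_iff)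
  \<comment> \<open>The witness \<open>y\<close> is the middle vertex of a path of length 2 from
    \<open>w\<close> to \<open>x\<close> inside \<open>X\<close>, or \<open>x\<close> itself if
    \<open>w\<close> is closer.\<close>
  have "W \<subseteq> (\<Union>y\<in>?N x \<inter> X. ?N y \<inter> W)"
  proof
    fix w assume w: "w \<in> W"
    then have "x = w \<or> w \<rightarrow> x \<or> (\<exists>z\<in>X. w \<rightarrow> z \<and> z \<rightarrow> x)"
      using club WX x by (force simp: two_club_iff)
    then show "w \<in> (\<Union>y\<in>?N x \<inter> X. ?N y \<inter> W)"
      using w x by (auto simp: closed_neighborhood_def)
  qed
  then have "card W \<le> card (\<Union>y\<in>?N x \<inter> X. ?N y \<inter> W)"
    using fin by (intro card_mono) auto
  also have "\<dots> \<le> (\<Sum>y\<in>?N x \<inter> X. card (?N y \<inter> W))"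
    using fin by (intro card_UN_le) auto
  also have "\<dots> \<le> (\<Sum>y\<in>?N x \<inter> X. M)"
    using M XV by (intro sum_mono) auto
  finally have dominating: "card W \<le> d * M"
    by (simp add: d_def)
  have "card W * d = (\<Sum>w\<in>W. d)"
    by simp
  also have "\<dots> \<le> (\<Sum>w\<in>W. card (?N w \<inter> X))"
    using x_min WX by (intro sum_mono) (auto simp: d_def)
  \<comment> \<open>Double counting of the pairs of \<open>w\<close> in \<open>W\<close> and
    \<open>v\<close> in \<open>X\<close> with \<open>v\<close> in \<open>?N w\<close>, a symmetric
    relation.\<close>
  also have "\<dots> = (\<Sum>w\<in>W. \<Sum>v\<in>X. if v \<in> ?N w then 1 else 0)"
    using fin by (simp add: sum.If_cases Int_commute)
  also have "\<dots> = (\<Sum>v\<in>X. \<Sum>w\<in>W. if v \<in> ?N w then 1 else 0)"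
    by (rule sum.swap)
  also have "\<dots> = (\<Sum>v\<in>X. card (?N v \<inter> W))"
    using fin by (subst closed_neighborhood_sym) (simp add: sum.If_cases Int_commute)
  also have "\<dots> \<le> (\<Sum>v\<in>X. M)"
    using M XV by (intro sum_mono) auto
  finally have averaging: "card W * d \<le> card X * M"
    by simp
  \<comment> \<open>Multiplying the two bounds avoids deciding which is stronger: \<open>d\<close>
    cancels, and a square root remains to be taken.\<close>
  have "d * (card W)\<^sup>2 = card W * (card W * d)"
    by (simp add: power2_eq_square)
  also have "\<dots> \<le> (d * M) * (card X * M)"
    using dominating averaging by (rule mult_mono) auto
  also have "\<dots> = d * (card X * M\<^sup>2)"
    by (simp add: power2_eq_square)
  also have "\<dots> \<le> d * (card (verts G) * M\<^sup>2)"
    using card_mono[OF finite_verts XV] by simp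
  finally have "(card W)\<^sup>2 \<le> card (verts G) * M\<^sup>2"
    using \<open>d > 0\<close> by simp
  then have "(real (card W))\<^sup>2 \<le> real (card (verts G)) * (real M)\<^sup>2"
    by (metis of_nat_le_iff of_nat_mult of_nat_power)
  then have "(real (card W))\<^sup>2 \<le> (sqrt (real (card (verts G))) * real M)\<^sup>2"
    by (simp add: power_mult_distrib)
  then show ?thesis
    by (rule power2_le_imp_le) simp
qed simp

lemma finite_two_club_cover:
  assumes "two_club_cover G \<C>"
  shows "finite \<C>"
proof -
  have "\<C> \<subseteq> Pow (verts G)"
    using assms by (auto simp: two_club_cover_def)
  then show ?thesis
    by (rule finite_subset) simp
qed

text \<open>The traces \<open>X \<inter> U\<close> of the clubs cover \<open>U\<close>. What any
  vertex covers of one trace is at most what the greedy choice covers of all of \<open>U\<close>, so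
  \<open>two_club_max_coverage\<close> bounds every trace by the same quantity.\<close>

lemma greedy_coverage:
  assumes cover: "two_club_cover G \<C>" and rule: "greedy_rule G sel"
    and U: "U \<subseteq> verts G" "U \<noteq> {}"
  shows "real (card U) \<le> real (card \<C>) * sqrt (real (card (verts G)))
           * real (card (closed_neighborhood G (sel U) \<inter> U))"
proof -
  let ?M = "card (closed_neighborhood G (sel U) \<inter> U)"
  have finU: "finite U"
    using U(1) finite_verts by (rule finite_subset)
  have M: "card (closed_neighborhood G v \<inter> U) \<le> ?M" if "v \<in> verts G" for v
    using rule U that by (auto simp: greedy_rule_def is_arg_max_linorder)
  have part: "real (card (X \<inter> U)) \<le> sqrt (real (card (verts G))) * real ?M" if "X \<in> \<C>" for X
  proof (rule two_club_max_coverage)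
    show "two_club G X"
      using cover that by (simp add: two_club_cover_def)
    fix v assume "v \<in> verts G"
    have "card (closed_neighborhood G v \<inter> (X \<inter> U)) \<le> card (closed_neighborhood G v \<inter> U)"
      using finU by (intro card_mono) auto
    then show "card (closed_neighborhood G v \<inter> (X \<inter> U)) \<le> ?M"
      using M[OF \<open>v \<in> verts G\<close>] by simp
  qed auto
  have "U = (\<Union>X\<in>\<C>. X \<inter> U)"
    using cover U by (auto simp: two_club_cover_def)
  then have "card U \<le> (\<Sum>X\<in>\<C>. card (X \<inter> U))"
    by (metis card_UN_le finite_two_club_cover[OF cover])
  then have "real (card U) \<le> (\<Sum>X\<in>\<C>. real (card (X \<inter> U)))"
    by (metis of_nat_le_iff of_nat_sum)
  also have "\<dots> \<le> (\<Sum>X\<in>\<C>. sqrt (real (card (verts G))) * real ?M)"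
    by (intro sum_mono part)
  finally show ?thesis
    by (simp add: mult.assoc)
qed

text \<open>Induction on the size of \<open>U\<close>, for any accumulator \<open>\<A>\<close>.
  While vertices remain after a step, \<open>K * ln (card U)\<close> has dropped by at least 1,
  which pays for the added club; the extra 1 pays for the step that empties \<open>U\<close>. The
  clause for empty \<open>U\<close> keeps that 1 from being charged twice.\<close>

lemma greedy_loop:
  assumes rule: "greedy_rule G sel"
    and K: "K > 0" "\<And>U. U \<subseteq> verts G \<Longrightarrow> U \<noteq> {} \<Longrightarrow>
      real (card U) \<le> K * real (card (closed_neighborhood G (sel U) \<inter> U))"
    and "U \<subseteq> verts G" "finite \<A>"
  shows "\<exists>\<S>. while_option (\<lambda>(U, \<S>). U \<noteq> {})
      (\<lambda>(U, \<S>). let C = closed_neighborhood G (sel U) in (U - C, insert C \<S>)) (U, \<A>) = Some ({}, \<S>)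
    \<and> \<A> \<subseteq> \<S> \<and> \<S> \<subseteq> \<A> \<union> closed_neighborhood G ` verts G \<and> U \<subseteq> \<Union>\<S>
    \<and> (U = {} \<longrightarrow> \<S> = \<A>)
    \<and> (U \<noteq> {} \<longrightarrow> real (card \<S>) \<le> real (card \<A>) + 1 + K * ln (real (card U)))"
  using \<open>U \<subseteq> verts G\<close> \<open>finite \<A>\<close>
proof (induction "card U" arbitrary: U \<A> rule: less_induct)
  case less
  show ?case
  proof (cases "U = {}")
    case True
    then show ?thesis
      by (subst while_option_unfold) auto
  next
    case False
    define C where "C = closed_neighborhood G (sel U)"
    have finU: "finite U"
      using less.prems(1) finite_verts by (rule finite_subset)
    then have U_pos: "card U > 0"
      using False by (simp add: card_gt_0_iff)
    have sel: "sel U \<in> verts G"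
      using rule less.prems(1) False by (auto simp: greedy_rule_def is_arg_max_def)
    have cov: "real (card U) \<le> K * real (card (C \<inter> U))"
      using K(2) less.prems(1) False by (simp add: C_def)
    \<comment> \<open>A choice covering nothing new would contradict \<open>cov\<close>; this
      progress gives termination.\<close>
    have CU_pos: "card (C \<inter> U) > 0"
      using cov U_pos by (cases "card (C \<inter> U)") auto
    have split: "card U = card (U - C) + card (C \<inter> U)"
      using finU card_Int_Diff[of U C] by (simp add: Int_commute)
    have smaller: "card (U - C) < card U" "U - C \<subseteq> verts G" "finite (insert C \<A>)"
      using split CU_pos less.prems by auto
    obtain \<S> where \<S>: "while_option (\<lambda>(U, \<S>). U \<noteq> {})
        (\<lambda>(U, \<S>). let C = closed_neighborhood G (sel U) in (U - C, insert C \<S>))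
        (U - C, insert C \<A>) = Some ({}, \<S>)"
      "insert C \<A> \<subseteq> \<S>" "\<S> \<subseteq> insert C \<A> \<union> closed_neighborhood G ` verts G" "U - C \<subseteq> \<Union>\<S>"
      "U - C = {} \<Longrightarrow> \<S> = insert C \<A>"
      "U - C \<noteq> {} \<Longrightarrow> real (card \<S>) \<le> real (card (insert C \<A>)) + 1 + K * ln (real (card (U - C)))"
      using less.hyps[OF smaller] by blast
    have ins: "real (card (insert C \<A>)) \<le> real (card \<A>) + 1"
      using less.prems(2) by (simp add: card_insert_if)
    have "real (card \<S>) \<le> real (card \<A>) + 1 + K * ln (real (card U))"
    proof (cases "U - C = {}")
      case True
      have "0 \<le> K * ln (real (card U))"
        using K(1) U_pos by simp
      then show ?thesis
        using \<S>(5)[OF True] ins by simp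
    next
      case False
      then have UC_pos: "card (U - C) > 0"
        using finU by (simp add: card_gt_0_iff)
      \<comment> \<open>This is \<open>ln t \<le> t - 1\<close> at the ratio of remaining to
        previously uncovered vertices.\<close>
      have "ln (real (card (U - C))) - ln (real (card U))
          \<le> (real (card (U - C)) - real (card U)) / real (card U)"
        using UC_pos U_pos ln_le_minus_one[of "real (card (U - C)) / real (card U)"]
        by (simp add: ln_div diff_divide_distrib)
      also have "\<dots> = - real (card (C \<inter> U)) / real (card U)"
        using split by simp
      also have "\<dots> \<le> - 1 / K"
        using cov K(1) U_pos by (simp add: field_simps)
      finally have "K * ln (real (card (U - C))) + 1 \<le> K * ln (real (card U))"
        using K(1) by (simp add: field_simps)
      then show ?thesis
        using \<S>(6)[OF False] ins by simp
    qed
    then show ?thesis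
      using \<S>(1-4) sel False
      by (subst while_option_unfold) (auto simp: C_def Let_def)
  qed
qed

end

section \<open>From the step count to the stated bound\<close>

lemma greedy_steps_le_approximation_bound:
  fixes s k n :: nat
  assumes n: "n \<ge> 2" and k: "k \<ge> 1"
    and s: "real s \<le> 1 + real k * sqrt (real n) * ln (real n)"
  shows "real s \<le> 2 * real n powr (1 / 2) * ln (real n) powr (3 / 2) * real k"
proof (cases "n = 2")
  case True
  \<comment> \<open>Since \<open>ln 2 < 1\<close>, raising it to the power 3/2 shrinks it, so
    numerical bounds are needed. This one is tight enough to keep \<open>sqrt 2 * ln 2\<close> below
    1.\<close>
  have sqrt2: "sqrt 2 \<le> 1415 / (1000 :: real)"
    by (rule real_le_lsqrt) (auto simp: power2_eq_square)
  have "sqrt 2 * ln 2 \<le> (1415 / 1000) * (25 / 36 :: real)"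
    using sqrt2 ln2_le_25_over_36 by (intro mult_mono) auto
  then have upper: "sqrt 2 * ln 2 \<le> (983 / 1000 :: real)"
    by simp
  \<comment> \<open>With 2/3 as lower bound for \<open>ln 2\<close>, the target coefficient of
    \<open>k\<close> is at least \<open>8 / 3 * sqrt (1 / 3)\<close>, just above 3/2.\<close>
  have "577 / 1000 \<le> sqrt (1 / 3 :: real)"
    by (rule real_le_rsqrt) (auto simp: power2_eq_square)
  then have "3 / 2 \<le> 2 * (4 / 3 * sqrt (1 / 3 :: real))"
    by simp
  also have "4 / 3 * sqrt (1 / 3) = sqrt 2 * (2 / 3 * sqrt (2 / 3 :: real))"
    by (simp add: real_sqrt_divide)
  also have "2 / 3 * sqrt (2 / 3) = (2 / 3 :: real) powr (3 / 2)"
    using powr_add[of "2 / 3 :: real" 1 "1 / 2"] by (simp add: powr_half_sqrt)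
  also have "\<dots> \<le> (ln 2 :: real) powr (3 / 2)"
    using ln2_ge_two_thirds by (intro powr_mono2) auto
  finally have lower: "3 / 2 \<le> 2 * (sqrt 2 * (ln 2 :: real) powr (3 / 2))"
    by simp
  have "real s \<le> 1 + real k * (sqrt 2 * ln 2)"
    using s True by (simp add: mult.assoc)
  also have "\<dots> \<le> 1 + real k * (983 / 1000)"
    using upper by (intro add_left_mono mult_left_mono) auto
  finally have s': "real s \<le> 1 + real k * (983 / 1000)" .
  \<comment> \<open>For \<open>k = 1\<close> the real bound 1.983 is too weak, but \<open>s\<close>
    is an integer, so \<open>s \<le> 1\<close>.\<close>
  have "real s \<le> 3 / 2 * real k"
  proof (cases "k = 1")
    case True
    then have "s \<le> 1"
      using s' by simp
    then show ?thesis
      using True by simp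
  next
    case False
    then have "real k \<ge> 2"
      using k by simp
    then show ?thesis
      using s' by simp
  qed
  also have "\<dots> \<le> 2 * (sqrt 2 * (ln 2 :: real) powr (3 / 2)) * real k"
    using lower by (rule mult_right_mono) simp
  finally show ?thesis
    using True by (simp add: powr_half_sqrt mult.assoc)
next
  case False
  then have "3 \<le> real n"
    using n by simp
  then have "exp 1 \<le> real n"
    using exp_le by linarith
  then have ln1: "ln (real n) \<ge> 1"
    using n by (simp add: ln_ge_iff)
  have "1 \<le> sqrt (real n)"
    using n by simp
  \<comment> \<open>The additive 1 is absorbed into this product at the cost of the factor
    2.\<close>
  with ln1 k have "1 * 1 * 1 \<le> real k * sqrt (real n) * ln (real n)"
    by (intro mult_mono) auto
  then have "real s \<le> 2 * (real k * sqrt (real n) * ln (real n))"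
    using s by simp
  also have "\<dots> \<le> 2 * (real k * sqrt (real n) * ln (real n) powr (3 / 2))"
    using ln1 powr_mono[of 1 "3 / 2" "ln (real n)"] by (intro mult_left_mono) auto
  finally show ?thesis
    by (simp add: powr_half_sqrt mult_ac)
qed

text \<open>A single vertex is excluded from the bound: \<open>ln 1 = 0\<close> makes the right-hand
  side 0, yet one club is returned.\<close>

theorem theorem5:
  fixes G :: "('a, 'b) pre_digraph"
    and sel :: "'a set \<Rightarrow> 'a"
    and OPT :: "'a set set"
  assumes "graph G"
    and "greedy_rule G sel"
    and "minimum_two_club_cover G OPT"
  shows "\<exists>\<S>. club_cover_approx sel G = Some \<S> \<and> two_club_cover G \<S> \<and>
           (card (verts G) \<noteq> 1 \<longrightarrow>
              real (card \<S>) \<le>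
                2 * real (card (verts G)) powr (1 / 2) * ln (real (card (verts G))) powr (3 / 2)
                  * real (card OPT))"
proof -
  interpret graph G by fact
  have OPT: "two_club_cover G OPT"
    using assms(3) by (simp add: minimum_two_club_cover_def is_arg_min_def)
  show ?thesis
  proof (cases "verts G = {}")
    case True
    then have "club_cover_approx sel G = Some {}"
      by (simp add: club_cover_approx_def while_option_unfold)
    then show ?thesis
      using True by (simp add: two_club_cover_def)
  next
    case False
    define K where "K = real (card OPT) * sqrt (real (card (verts G)))"
    have n_pos: "card (verts G) > 0"
      using False by (simp add: card_gt_0_iff)
    have "OPT \<noteq> {}"
      using OPT False by (auto simp: two_club_cover_def)
    then have k_pos: "card OPT > 0"
      using finite_two_club_cover[OF OPT] by (simp add: card_gt_0_iff)
    have "K > 0"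
      using n_pos k_pos by (simp add: K_def)
    from greedy_loop[OF assms(2) this, of "verts G" "{}"] greedy_coverage[OF OPT assms(2)]
    obtain \<S> where \<S>: "club_cover_approx sel G = Some \<S>"
      "\<S> \<subseteq> closed_neighborhood G ` verts G" "verts G \<subseteq> \<Union>\<S>"
      "real (card \<S>) \<le> 1 + K * ln (real (card (verts G)))"
      using False by (auto simp: club_cover_approx_def K_def)
    have clubs: "\<forall>X\<in>\<S>. two_club G X"
      using \<S>(2) two_club_closed_neighborhood by auto
    then have "\<Union>\<S> \<subseteq> verts G"
      by (auto simp: two_club_def)
    then have "two_club_cover G \<S>"
      using clubs \<S>(3) by (auto simp: two_club_cover_def)
    moreover have "real (card \<S>) \<le> 2 * real (card (verts G)) powr (1 / 2)
        * ln (real (card (verts G))) powr (3 / 2) * real (card OPT)" if "card (verts G) \<noteq> 1"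
      using that n_pos k_pos \<S>(4)
      by (intro greedy_steps_le_approximation_bound) (auto simp: K_def)
    ultimately show ?thesis
      using \<S>(1) by blast
  qed
qed

end
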